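(* Let $G$ be a finite graph with four distinct marked vertices $v_1,v_2,v_3,v_4$. Let $A_1,\dots,A_6$, $B_1,\dots,B_7$, $(1,1,1,1)$ and $(1,2,3,4)$ denote the spanning forest polynomials of $G$ with respect to these marked vertices (as defined in the context). Then $$ \begin{aligned} (1,1,1,1)\,(1,2,3,4) ={}& (1 - x_1 - x_2) A_4 B_1 + x_7 A_2 B_4 + (1 - x_3 - x_2) A_5 B_1 \\ &+ (1 - x_1 - x_4) A_6 B_1 + x_2 A_2 B_2 + (x_3 + x_2 - x_5) A_3 B_2 \\ &+ (1 - x_1 - x_6) A_6 B_2 + x_1 A_1 B_3 + (x_1 - x_7 + x_4) A_3 B_3 \\ &+ (x_1 - x_8 + x_6) A_5 B_3 + x_5 A_1 B_4 + (x_1 - x_5 + x_4) A_3 B_5 \\ &+ (x_1 - x_5 + x_6) A_5 B_5 + x_3 A_1 B_6 + (x_3 + x_2 - x_7) A_3 B_6 \\ &+ (1 - x_1 - x_2 + x_8 - x_6) A_4 B_6 + (x_2 + x_7 - x_4) A_2 B_7 \\ &+ (1 - x_1 - x_7 + x_8 - x_6) A_6 B_6 + (x_1 + x_5 - x_3) A_1 B_7 \\ &+ (1 + x_5 - x_3 - x_2 - x_8) A_5 B_7 \\ &+ (1 - x_1 + x_7 - x_4 - x_8) A_6 B_7 \\ &+ x_8 A_4 B_4 + x_4 A_2 B_5 + x_6 A_4 B_5 \end{aligned} $$ for any $x_1,\dots,x_8$ (i.e. the identity holds with $x_1,\dots,x_8$ as indeterminates commuting with the edge variables, and hence for all scalar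 values of the $x_i$).
   Context: Let $G$ be a finite graph (parallel edges and loops allowed), and assign to each edge $e$ a variable $\alpha_e$. Spanning forest polynomials: for a set partition $P=P_1\cup\cdots\cup P_k$ (nonempty parts) of a subset of the vertices of $G$, define $$\Phi_G^P=\sum_F\prod_{e\notin F}\alpha_e ,$$ where the sum runs over spanning forests $F=T_1\cup\cdots\cup T_k$ of $G$ (acyclic subgraphs containing all vertices of $G$) with exactly $k$ component trees $T_1,\dots,T_k$ such that the vertices of $P_i$ all lie in $T_i$ for each $i$ (so different parts lie in different trees). The product is over the edges of $G$ not in $F$. Trees consisting of a single vertex are allowed. Notation: for distinct vertices $v_1,v_2,v_3,v_4$ of $G$ and $c_i\in\{1,2,3,4,-\}$, write $(c_1,c_2,c_3,c_4)$ for $\Phi_G^P$ where $P$ is the partition of $\{v_i : c_i\neq -\}$ having one part $\{v_i: c_i=\ell\}$ for each distinct integer $\ell$ occurring among the $c_i$, and no other parts. Set $$A_1=(1,1,2,3),\ A_2=(1,2,1,3),\ A_3=(1,2,2,3),\ A_4=(1,2,3,1),\ A_5=(1,2,3,2),\ A_6=(1,2,3,3),$$ $$B_1=(1,1,1,2),\ B_2=(1,1,2,1),\ B_3=(1,2,1,1),\ B_4=(1,2,2,2),\ B_5=(1,1,2,2),\ B_6=(1,2,1,2),\ B_7=(1,2,2,1).$$ *)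

theory Defs
  imports "HOL-Library.Poly_Mapping" "HOL-Library.Disjoint_Sets"
begin

text \<open>
  Finite undirected multigraphs: an edge is a name, so parallel edges are distinct edges with the
  same \<open>ends\<close>; a loop at \<open>u\<close> has \<open>ends = {u}\<close>.
\<close>

record ('v, 'e) multigraph =
  verts :: "'v set"
  edges :: "'e set"
  ends :: "'e \<Rightarrow> 'v set"

definition finite_multigraph :: "('v, 'e) multigraph \<Rightarrow> bool" where
  "finite_multigraph G \<longleftrightarrow>
     finite (verts G) \<and> finite (edges G) \<and>
     (\<forall>e\<in>edges G. \<exists>u\<in>verts G. \<exists>w\<in>verts G. ends G e = {u, w})"

text \<open>
  A cycle visits distinct vertices \<open>us ! 0, us ! 1, \<dots>\<close> along distinct edges and returns to its start.
  Length 1 gives the loops, length 2 the pairs of parallel edges.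
\<close>

definition is_cycle :: "('v, 'e) multigraph \<Rightarrow> 'v list \<Rightarrow> 'e list \<Rightarrow> bool" where
  "is_cycle G us es \<longleftrightarrow>
     es \<noteq> [] \<and> length us = length es \<and> distinct us \<and> distinct es \<and>
     (\<forall>i<length es. ends G (es ! i) = {us ! i, us ! (Suc i mod length es)})"

definition acyclic_edges :: "('v, 'e) multigraph \<Rightarrow> 'e set \<Rightarrow> bool" where
  "acyclic_edges G F \<longleftrightarrow> (\<nexists>us es. is_cycle G us es \<and> set es \<subseteq> F)"

text \<open>
  An edge set \<open>F\<close> stands for the subgraph with edges \<open>F\<close> and \<^emph>\<open>all\<close> vertices of the graph;
  \<open>components G F\<close> are the vertex sets of its connected components, including single vertices.
\<close>

definition connected_rel :: "('v, 'e) multigraph \<Rightarrow> 'e set \<Rightarrow> ('v \<times> 'v) set" where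
  "connected_rel G F =
     {(u, w). u \<in> verts G \<and> w \<in> verts G \<and> (u, w) \<in> {(a, b). \<exists>e\<in>F. ends G e = {a, b}}\<^sup>*}"

definition components :: "('v, 'e) multigraph \<Rightarrow> 'e set \<Rightarrow> 'v set set" where
  "components G F = verts G // connected_rel G F"

text \<open>
  The bijection \<open>T\<close> assigns to each part the tree containing it; so the forest has exactly as many
  trees as there are parts, and different parts lie in different trees.
\<close>

definition spanning_forests :: "('v, 'e) multigraph \<Rightarrow> 'v set set \<Rightarrow> 'e set set" where
  "spanning_forests G P =
     {F. F \<subseteq> edges G \<and> acyclic_edges G F \<and>
         (\<exists>T. bij_betw T P (components G F) \<and> (\<forall>p\<in>P. p \<subseteq> T p))}"

text \<open>
  Polynomials over \<open>'a\<close> in variables indexed by \<open>'e\<close>: finitely supported maps from monomials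
  (themselves finitely supported exponent maps) to coefficients.
\<close>

type_synonym ('e, 'a) edge_poly = "('e \<Rightarrow>\<^sub>0 nat) \<Rightarrow>\<^sub>0 'a"

definition edge_var :: "'e \<Rightarrow> ('e, 'a::comm_ring_1) edge_poly" where
  "edge_var e = Poly_Mapping.single (Poly_Mapping.single e 1) 1"

definition forest_poly ::
    "('v, 'e) multigraph \<Rightarrow> 'v set set \<Rightarrow> ('e, 'a::comm_ring_1) edge_poly" where
  "forest_poly G P = (\<Sum>F\<in>spanning_forests G P. \<Prod>e\<in>edges G - F. edge_var e)"

text \<open>
  The partition of the listed vertices \<open>vs\<close> in which \<open>vs ! i\<close> and \<open>vs ! j\<close> share a part iff they
  carry the same label, \<open>cs ! i = cs ! j\<close>.
\<close>

definition label_partition :: "'v list \<Rightarrow> nat list \<Rightarrow> 'v set set" where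
  "label_partition vs cs = (\<lambda>l. {vs ! i | i. i < length vs \<and> cs ! i = l}) ` set cs"

lemma partition_on_label_partition:
  assumes "distinct vs" "length cs = length vs"
  shows "partition_on (set vs) (label_partition vs cs)"
proof (rule partition_onI)
  show "\<Union> (label_partition vs cs) = set vs"
    using assms(2) by (fastforce simp: label_partition_def in_set_conv_nth)
  show "disjnt p q" if "p \<in> label_partition vs cs" "q \<in> label_partition vs cs" "p \<noteq> q" for p q
    using that assms(1) by (auto simp: label_partition_def disjnt_iff nth_eq_iff_index_eq)
  show "{} \<notin> label_partition vs cs"
    using assms(2) by (force simp: label_partition_def in_set_conv_nth)
qed

definition marked_forest_poly ::
    "('v, 'e) multigraph \<Rightarrow> 'v list \<Rightarrow> nat list \<Rightarrow> ('e, 'a::comm_ring_1) edge_poly" where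
  "marked_forest_poly G vs cs = forest_poly G (label_partition vs cs)"

end

theory Submission
  imports Defs
begin

text \<open>
  Regard \<open>G\<close> as an electrical network in which \<open>e\<close> has resistance \<open>\<alpha>\<^sub>e\<close>. For a root set \<open>S\<close> and \<open>r \<in> S\<close>, let
  \<open>h(w)\<close> be the weighted count of the forests with one tree per root in which \<open>w\<close> lies in the tree
  of \<open>r\<close>. Regrouping pairs (forest, added edge) by their union \<open>H\<close> shows that \<open>h\<close> is an electrical
  potential: each \<open>H\<close> joining \<open>r\<close> to one other root \<open>t\<close> contributes a unit flow from \<open>r\<close> to \<open>t\<close>, so
  current enters and leaves the network only at the roots. Green's identity for two such potentials,
  one with \<open>S = {v\<^sub>1, v\<^sub>2, v\<^sub>3, v\<^sub>4}\<close> and \<open>r = v\<^sub>i\<close>, the other with \<open>S = {v\<^sub>k, v\<^sub>1}\<close> and \<open>r = v\<^sub>k\<close>, gives for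
  each pair \<open>i, k \<in> {2, 3, 4}\<close> a bilinear relation between the \<open>A\<close>'s and the \<open>B\<close>'s with right-hand
  side \<open>(1,1,1,1) (1,2,3,4)\<close> if \<open>i = k\<close> and \<open>0\<close> otherwise. The identity is a linear combination of
  these nine relations, its eight parameters being the freedom in the choice of the combination.
\<close>

section \<open>Connection by edge sets and acyclicity\<close>

text \<open>
  \<open>linked\<close> lives on the whole vertex type, where a vertex outside the graph is linked only to
  itself; on the vertices of the graph it agrees with \<open>connected_rel\<close>.
\<close>

definition linked :: "('v, 'e) multigraph \<Rightarrow> 'e set \<Rightarrow> 'v \<Rightarrow> 'v \<Rightarrow> bool" where
  "linked G F u w \<longleftrightarrow> (u, w) \<in> {(x, y). \<exists>e\<in>F. ends G e = {x, y}}\<^sup>*"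

lemma linked_refl [simp, intro!]: "linked G F u u"
  by (simp add: linked_def)

lemma linked_trans: "linked G F u v \<Longrightarrow> linked G F v w \<Longrightarrow> linked G F u w"
  unfolding linked_def by (rule rtrancl_trans)

lemma linked_sym: "linked G F u v \<Longrightarrow> linked G F v u"
proof -
  have "sym {(x, y). \<exists>e\<in>F. ends G e = {x, y}}"
    by (auto simp: sym_def insert_commute)
  then show "linked G F u v \<Longrightarrow> linked G F v u"
    unfolding linked_def by (meson sym_rtrancl symD)
qed

lemma linked_commute: "linked G F u v \<longleftrightarrow> linked G F v u"
  by (blast intro: linked_sym)

lemma linked_edge: "e \<in> F \<Longrightarrow> ends G e = {u, w} \<Longrightarrow> linked G F u w"
  unfolding linked_def by auto

lemma linked_mono: "linked G F u w \<Longrightarrow> F \<subseteq> F' \<Longrightarrow> linked G F' u w"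
  unfolding linked_def by (erule rtrancl_mono[THEN subsetD, rotated]) auto

text \<open>One crossing of the new edge suffices. Induct on the walk: each time it crosses
  \<open>e\<close> it stands at \<open>x\<close> or \<open>y\<close>, and the induction hypothesis
  already says how \<open>u\<close> reaches that end, so repeated crossings collapse.\<close>

lemma linked_insert:
  assumes "ends G e = {x, y}"
  shows "linked G (insert e F) u w \<longleftrightarrow>
    linked G F u w \<or> linked G F u x \<and> linked G F y w \<or> linked G F u y \<and> linked G F x w"
    (is "?L \<longleftrightarrow> ?R")
proof
  assume ?R
  moreover have "linked G (insert e F) x y" "linked G (insert e F) y x"
    using assms by (auto intro: linked_edge linked_sym)
  moreover have "linked G F s t \<Longrightarrow> linked G (insert e F) s t" for s t
    by (blast intro: linked_mono)
  ultimately show ?L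
    by (meson linked_trans)
next
  assume ?L
  then show ?R
    unfolding linked_def[of G "insert e F"]
  proof (induction rule: rtrancl_induct)
    case base
    show ?case by simp
  next
    case (step v w)
    then consider f where "f \<in> F" "ends G f = {v, w}" | "v = x" "w = y" | "v = y" "w = x"
      using assms by (auto simp: doubleton_eq_iff)
    then show ?case
    proof cases
      case 1
      then have "linked G F v w" by (rule linked_edge)
      then show ?thesis using step.IH by (meson linked_trans)
    qed (use step.IH in auto)
  qed
qed

lemma linked_simple_path:
  assumes "linked G F u w"
  obtains us es where "us \<noteq> []" "hd us = u" "last us = w" "distinct us"
    "length us = Suc (length es)" "set es \<subseteq> F"
    "\<forall>i<length es. ends G (es ! i) = {us ! i, us ! Suc i}"
proof -
  have "\<exists>us es. us \<noteq> [] \<and> hd us = u \<and> last us = w \<and> distinct us \<and> length us = Suc (length es) \<and>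
    set es \<subseteq> F \<and> (\<forall>i<length es. ends G (es ! i) = {us ! i, us ! Suc i})"
    using assms unfolding linked_def
  proof (induction rule: converse_rtrancl_induct)
    case base
    show ?case by (rule exI[of _ "[w]"], rule exI[of _ "[]"]) simp
  next
    case (step x y)
    then obtain us es where IH: "us \<noteq> []" "hd us = y" "last us = w" "distinct us"
      "length us = Suc (length es)" "set es \<subseteq> F"
      "\<forall>i<length es. ends G (es ! i) = {us ! i, us ! Suc i}" by blast
    from step.hyps(1) obtain e where e: "e \<in> F" "ends G e = {x, y}" by auto
    show ?case
    proof (cases "x \<in> set us")
      case True
      then obtain k where k: "k < length us" "us ! k = x" by (auto simp: in_set_conv_nth)
      \<comment> \<open>The path from \<open>y\<close> already passes through \<open>x\<close>;
        starting it there instead keeps its vertices distinct.\<close>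
      show ?thesis
        using IH k
        by (intro exI[of _ "drop k us"] exI[of _ "drop k es"])
          (auto simp: hd_drop_conv_nth dest: in_set_dropD)
    next
      case False
      show ?thesis
      proof (intro exI[of _ "x # us"] exI[of _ "e # es"] conjI allI impI)
        show "ends G ((e # es) ! i) = {(x # us) ! i, (x # us) ! Suc i}" if "i < length (e # es)" for i
          using that IH e by (cases i) (auto simp: hd_conv_nth)
      qed (use False IH e in auto)
    qed
  qed
  then show thesis using that by blast
qed

section \<open>Acyclicity when an edge is added or removed\<close>

lemma acyclic_edges_mono: "acyclic_edges G F \<Longrightarrow> F' \<subseteq> F \<Longrightarrow> acyclic_edges G F'"
  unfolding acyclic_edges_def by blast

text \<open>A simple path from \<open>x\<close> to \<open>y\<close> in \<open>F\<close> is closed to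
  a cycle by \<open>e\<close>. If \<open>x = y\<close>, the path is a single vertex and the cycle is
  the loop \<open>e\<close>.\<close>

lemma acyclic_edges_insertD:
  assumes acyc: "acyclic_edges G (insert e F)" and e: "e \<notin> F" "ends G e = {x, y}"
  shows "\<not> linked G F x y"
proof
  assume "linked G F x y"
  then obtain us es where p: "us \<noteq> []" "hd us = x" "last us = y" "distinct us"
    "length us = Suc (length es)" "set es \<subseteq> F"
    "\<forall>i<length es. ends G (es ! i) = {us ! i, us ! Suc i}"
    by (rule linked_simple_path)
  \<comment> \<open>A repeated edge would join two different pairs of consecutive path vertices,
    which distinctness of \<open>us\<close> forbids.\<close>
  have "distinct es"
    unfolding distinct_conv_nth
  proof (intro allI impI notI)
    fix i j assume ij: "i < length es" "j < length es" "i \<noteq> j" "es ! i = es ! j"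
    then have "{us ! i, us ! Suc i} = {us ! j, us ! Suc j}"
      using p(7) by metis
    then show False
      using ij p(4,5) by (auto simp: doubleton_eq_iff nth_eq_iff_index_eq)
  qed
  have "is_cycle G us (es @ [e])"
    unfolding is_cycle_def
  proof (intro conjI allI impI)
    fix i assume "i < length (es @ [e])"
    then consider "i < length es" | "i = length es" by fastforce
    then show "ends G ((es @ [e]) ! i) = {us ! i, us ! (Suc i mod length (es @ [e]))}"
    proof cases
      case 1
      then show ?thesis using p(7) by (simp add: nth_append)
    next
      case 2
      then show ?thesis using p e by (auto simp: hd_conv_nth last_conv_nth)
    qed
  qed (use p \<open>distinct es\<close> e in auto)
  moreover have "set (es @ [e]) \<subseteq> insert e F"
    using p(6) by auto
  ultimately show False
    using acyc unfolding acyclic_edges_def by blast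
qed

text \<open>A cycle in \<open>insert e F\<close> has to use \<open>e\<close>; the rest of the cycle
  then links the two ends of \<open>e\<close> inside \<open>F\<close>.\<close>

lemma acyclic_edges_insertI:
  assumes acyc: "acyclic_edges G F" and e: "ends G e = {x, y}" and nl: "\<not> linked G F x y"
  shows "acyclic_edges G (insert e F)"
  unfolding acyclic_edges_def
proof (intro notI, elim exE conjE)
  fix us es assume cyc: "is_cycle G us es" and sub: "set es \<subseteq> insert e F"
  let ?n = "length es"
  have "e \<in> set es"
    using acyc cyc sub unfolding acyclic_edges_def by blast
  then obtain i where i: "i < ?n" "es ! i = e" by (auto simp: in_set_conv_nth)
  have n: "?n > 0" using i by auto
  have ends: "ends G (es ! j) = {us ! j, us ! (Suc j mod ?n)}" if "j < ?n" for j
    using cyc that by (simp add: is_cycle_def)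
  \<comment> \<open>Walk around the cycle from the vertex after position \<open>i\<close>. For
    \<open>k < ?n\<close> the walk has not yet come back to the edge at position \<open>i\<close>,
    and \<open>k = ?n - 1\<close> ends at \<open>us ! i\<close>.\<close>
  have "linked G F (us ! (Suc i mod ?n)) (us ! ((Suc i + k) mod ?n))" if "k < ?n" for k
    using that
  proof (induction k)
    case (Suc k)
    let ?j = "(Suc i + k) mod ?n"
    have "?j < ?n" using n by simp
    have "?j \<noteq> i"
    proof
      assume "?j = i"
      then have "(i + Suc k) mod ?n = (i + 0) mod ?n" using i by simp
      then have "?n dvd Suc k"
        using mod_eq_dvd_iff_nat[of i "i + Suc k" ?n] by simp
      then show False using Suc.prems by (auto dest: dvd_imp_le)
    qed
    then have "es ! ?j \<noteq> e"
      using cyc i \<open>?j < ?n\<close> by (auto simp: is_cycle_def nth_eq_iff_index_eq)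
    then have "es ! ?j \<in> F"
      using sub \<open>?j < ?n\<close> by (metis insertE nth_mem subsetD)
    moreover have "Suc ?j mod ?n = (Suc i + Suc k) mod ?n"
      by (simp add: mod_Suc_eq)
    ultimately have "linked G F (us ! ?j) (us ! ((Suc i + Suc k) mod ?n))"
      using ends[OF \<open>?j < ?n\<close>] by (metis linked_edge)
    with Suc show ?case by (meson Suc_lessD linked_trans)
  qed simp
  from this[of "?n - 1"] have "linked G F (us ! (Suc i mod ?n)) (us ! i)"
    using n i by simp
  with ends[OF i(1)] i(2) e nl show False
    by (auto simp: doubleton_eq_iff dest: linked_sym)
qed

section \<open>Forests as electrical potentials\<close>

text \<open>Every tree meets \<open>S\<close>, and \<open>R\<close> prescribes which members of
  \<open>S\<close> share a tree. With equality for \<open>R\<close> there is one tree per root;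
  \<open>joined_forests\<close> merges the trees of \<open>r\<close> and \<open>t\<close>
  only.\<close>

definition forests :: "('v, 'e) multigraph \<Rightarrow> 'v set \<Rightarrow> ('v \<Rightarrow> 'v \<Rightarrow> bool) \<Rightarrow> 'e set set" where
  "forests G S R =
     {F. F \<subseteq> edges G \<and> acyclic_edges G F \<and> (\<forall>v\<in>verts G. \<exists>s\<in>S. linked G F v s) \<and>
         (\<forall>s\<in>S. \<forall>t\<in>S. linked G F s t \<longleftrightarrow> R s t)}"

abbreviation rooted_forests :: "('v, 'e) multigraph \<Rightarrow> 'v set \<Rightarrow> 'e set set" where
  "rooted_forests G S \<equiv> forests G S (=)"

abbreviation joined_forests :: "('v, 'e) multigraph \<Rightarrow> 'v set \<Rightarrow> 'v \<Rightarrow> 'v \<Rightarrow> 'e set set" where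
  "joined_forests G S r t \<equiv> forests G S (\<lambda>s s'. s = s' \<or> {s, s'} = {r, t})"

text \<open>The choice of \<open>tail\<close> and \<open>head\<close> is an arbitrary orientation
  that fixes the signs of flows.\<close>

locale weighted_multigraph =
  fixes G :: "('v, 'e) multigraph"
    and tail head :: "'e \<Rightarrow> 'v"
    and a :: "'e \<Rightarrow> 'r::comm_ring_1"
  assumes finite_verts: "finite (verts G)"
    and finite_edges: "finite (edges G)"
    and ends_eq: "e \<in> edges G \<Longrightarrow> ends G e = {tail e, head e}"
    and tail_in_verts: "e \<in> edges G \<Longrightarrow> tail e \<in> verts G"
    and head_in_verts: "e \<in> edges G \<Longrightarrow> head e \<in> verts G"
begin

definition wt :: "'e set \<Rightarrow> 'r" where
  "wt F = (\<Prod>e\<in>edges G - F. a e)"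

definition incidence :: "'v \<Rightarrow> 'e \<Rightarrow> 'r" where
  "incidence w e = of_bool (w = tail e) - of_bool (w = head e)"

definition joined_weight :: "'v set \<Rightarrow> 'v \<Rightarrow> 'v \<Rightarrow> 'r" where
  "joined_weight S r t = sum wt (joined_forests G S r t)"

definition potential :: "'v set \<Rightarrow> 'v \<Rightarrow> 'v \<Rightarrow> 'r" where
  "potential S r w = (\<Sum>F\<in>rooted_forests G S. wt F * of_bool (linked G F w r))"

text \<open>
  The conductance of \<open>e\<close> is \<open>1 / a e\<close>. Since \<open>wt F / a e = wt (insert e F)\<close> for \<open>e \<notin> F\<close>, the current
  through \<open>e\<close> can be written without division.
\<close>

definition current :: "'v set \<Rightarrow> 'v \<Rightarrow> 'e \<Rightarrow> 'r" where
  "current S r e =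
     (\<Sum>F | F \<in> rooted_forests G S \<and> \<not> linked G F (tail e) (head e).
        wt (insert e F) * (of_bool (linked G F (tail e) r) - of_bool (linked G F (head e) r)))"

lemma finite_forests: "finite (forests G S R)"
  by (rule finite_subset[of _ "Pow (edges G)"]) (auto simp: forests_def finite_edges)

lemma wt_insert: "e \<in> edges G \<Longrightarrow> e \<notin> F \<Longrightarrow> wt F = a e * wt (insert e F)"
  unfolding wt_def using finite_edges
  by (subst prod.remove[of _ e]) (auto simp: Diff_insert2[symmetric] Diff_insert[symmetric])

text \<open>Forests linking the ends of \<open>e\<close> cancel in the potential difference. All
  others avoid \<open>e\<close>, so their weight has the factor \<open>a e\<close>.\<close>

lemma ohm:
  assumes e: "e \<in> edges G"
  shows "a e * current S r e = potential S r (tail e) - potential S r (head e)"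
proof -
  have "potential S r (tail e) - potential S r (head e) =
    (\<Sum>F\<in>rooted_forests G S. wt F * (of_bool (linked G F (tail e) r) - of_bool (linked G F (head e) r)))"
    by (simp add: potential_def right_diff_distrib sum_subtractf)
  also have "\<dots> = (\<Sum>F | F \<in> rooted_forests G S \<and> \<not> linked G F (tail e) (head e).
      wt F * (of_bool (linked G F (tail e) r) - of_bool (linked G F (head e) r)))"
  proof (rule sum.mono_neutral_right)
    show "\<forall>F\<in>rooted_forests G S - {F \<in> rooted_forests G S. \<not> linked G F (tail e) (head e)}.
      wt F * (of_bool (linked G F (tail e) r) - of_bool (linked G F (head e) r)) = 0"
    proof
      fix F assume "F \<in> rooted_forests G S - {F \<in> rooted_forests G S. \<not> linked G F (tail e) (head e)}"
      then have "linked G F (tail e) (head e)" by simp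
      then have "linked G F (tail e) r \<longleftrightarrow> linked G F (head e) r"
        by (meson linked_sym linked_trans)
      then show "wt F * (of_bool (linked G F (tail e) r) - of_bool (linked G F (head e) r)) = 0"
        by simp
    qed
  qed (auto simp: finite_forests)
  also have "\<dots> = a e * current S r e"
    unfolding current_def sum_distrib_left
  proof (rule sum.cong)
    fix F assume "F \<in> {F \<in> rooted_forests G S. \<not> linked G F (tail e) (head e)}"
    then have "e \<notin> F"
      using linked_edge[OF _ ends_eq[OF e]] by blast
    then show "wt F * (of_bool (linked G F (tail e) r) - of_bool (linked G F (head e) r)) =
      a e * (wt (insert e F) * (of_bool (linked G F (tail e) r) - of_bool (linked G F (head e) r)))"
      using wt_insert[OF e] by (simp add: mult.assoc)
  qed simp
  finally show ?thesis by simp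
qed

text \<open>
  Removing an edge \<open>e\<close> of the path from \<open>r\<close> to \<open>t\<close> leaves exactly one of \<open>r\<close>, \<open>t\<close> linked to \<open>tail e\<close>,
  so the second factor is the unit flow from \<open>r\<close> to \<open>t\<close> in the forest \<open>H\<close>. In this form it is additive
  along the path, which reduces the claim to a single edge.
\<close>

lemma path_divergence:
  assumes H: "H \<subseteq> edges G" "acyclic_edges G H" and "linked G H r t"
  shows "(\<Sum>e\<in>H. incidence w e *
      (of_bool (linked G (H - {e}) (tail e) r) - of_bool (linked G (H - {e}) (tail e) t))) =
    of_bool (w = r) - of_bool (w = t)"
  using assms(3)[unfolded linked_def]
proof (induction rule: rtrancl_induct)
  case base
  show ?case by simp
next
  case (step t t')
  let ?p = "\<lambda>t e. of_bool (linked G (H - {e}) (tail e) t) :: 'r"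
  have finite_H: "finite H"
    using H(1) finite_edges finite_subset by blast
  from step.hyps(2) obtain f where f: "f \<in> H" "ends G f = {t, t'}" by auto
  have "(\<Sum>e\<in>H. incidence w e * (?p t e - ?p t' e)) =
    incidence w f * (?p t f - ?p t' f) + (\<Sum>e\<in>H - {f}. incidence w e * (?p t e - ?p t' e))"
    using finite_H f(1) by (rule sum.remove)
  also have "(\<Sum>e\<in>H - {f}. incidence w e * (?p t e - ?p t' e)) = 0"
  proof (intro sum.neutral ballI)
    fix e assume "e \<in> H - {f}"
    then have "linked G (H - {e}) t t'"
      using f by (intro linked_edge[of f]) auto
    then have "linked G (H - {e}) (tail e) t \<longleftrightarrow> linked G (H - {e}) (tail e) t'"
      by (meson linked_sym linked_trans)
    then show "incidence w e * (?p t e - ?p t' e) = 0" by simp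
  qed
  also have "incidence w f * (?p t f - ?p t' f) = of_bool (w = t) - of_bool (w = t')"
  proof -
    have sep: "\<not> linked G (H - {f}) t t'"
      using f H(2) by (intro acyclic_edges_insertD[of G f]) (auto simp: insert_absorb)
    have "ends G f = {tail f, head f}"
      using f(1) H(1) ends_eq by blast
    with f(2) consider "tail f = t" "head f = t'" | "tail f = t'" "head f = t"
      by (auto simp: doubleton_eq_iff)
    then show ?thesis
      using sep by cases (auto simp: incidence_def dest: linked_sym)
  qed
  finally have "(\<Sum>e\<in>H. incidence w e * (?p t e - ?p t' e)) = of_bool (w = t) - of_bool (w = t')"
    by simp
  moreover have "(\<Sum>e\<in>H. incidence w e * (?p r e - ?p t' e)) =
    (\<Sum>e\<in>H. incidence w e * (?p r e - ?p t e)) + (\<Sum>e\<in>H. incidence w e * (?p t e - ?p t' e))"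
    by (simp add: sum.distrib[symmetric] distrib_left[symmetric])
  ultimately show ?case
    using step.IH by simp
qed

section \<open>Kirchhoff's current law by regrouping forests with an added edge\<close>

lemma joined_forests_unique:
  assumes "H \<in> joined_forests G S r t" "H \<in> joined_forests G S r t'"
    and "t \<in> S" "t' \<in> S" "r \<in> S" "t \<noteq> r"
  shows "t = t'"
  using assms unfolding forests_def by (auto simp: doubleton_eq_iff)

text \<open>Removing \<open>e\<close> splits one tree. Each piece keeps a root exactly when
  \<open>e\<close> lies on the path from \<open>r\<close> to \<open>t\<close>; the ends of
  \<open>e\<close> then fall on the two sides.\<close>

lemma rooted_removal_iff:
  assumes H: "H \<in> joined_forests G S r t" and e: "e \<in> H" and rt: "r \<in> S" "t \<in> S" "r \<noteq> t"
  shows "H - {e} \<in> rooted_forests G S \<longleftrightarrow> \<not> linked G (H - {e}) r t"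
    and "\<not> linked G (H - {e}) r t \<Longrightarrow>
      linked G (H - {e}) r (tail e) \<and> linked G (H - {e}) (head e) t \<or>
      linked G (H - {e}) r (head e) \<and> linked G (H - {e}) (tail e) t"
proof -
  let ?F = "H - {e}"
  have HE: "H \<subseteq> edges G" "acyclic_edges G H"
    and cover: "\<And>v. v \<in> verts G \<Longrightarrow> \<exists>s\<in>S. linked G H v s"
    and rel: "\<And>s s'. s \<in> S \<Longrightarrow> s' \<in> S \<Longrightarrow> linked G H s s' \<longleftrightarrow> s = s' \<or> {s, s'} = {r, t}"
    using H unfolding forests_def by auto
  have ins: "linked G H u v \<longleftrightarrow> linked G ?F u v \<or>
      linked G ?F u (tail e) \<and> linked G ?F (head e) v \<or>
      linked G ?F u (head e) \<and> linked G ?F (tail e) v" for u v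
    using linked_insert[of G e "tail e" "head e" ?F u v] HE(1) e ends_eq
    by (auto simp: insert_absorb)
  show split: "linked G ?F r (tail e) \<and> linked G ?F (head e) t \<or>
      linked G ?F r (head e) \<and> linked G ?F (tail e) t" if "\<not> linked G ?F r t"
    using ins[of r t] rel[OF rt(1,2)] that by simp
  show "?F \<in> rooted_forests G S \<longleftrightarrow> \<not> linked G ?F r t"
  proof
    assume "?F \<in> rooted_forests G S"
    then show "\<not> linked G ?F r t"
      using rt unfolding forests_def by auto
  next
    assume nl: "\<not> linked G ?F r t"
    have "\<exists>s\<in>S. linked G ?F v s" if "v \<in> verts G" for v
    proof -
      from cover[OF that] obtain s where s: "s \<in> S" "linked G H v s" by blast
      then consider "linked G ?F v s" | "linked G ?F v (tail e)" | "linked G ?F v (head e)"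
        using ins by blast
      then show ?thesis
        using split[OF nl] s(1) rt(1,2) by cases (meson linked_sym linked_trans)+
    qed
    moreover have "linked G ?F s s' \<longleftrightarrow> s = s'" if "s \<in> S" "s' \<in> S" for s s'
    proof
      assume l: "linked G ?F s s'"
      then have "linked G H s s'" by (rule linked_mono) auto
      with rel that have "s = s' \<or> {s, s'} = {r, t}" by blast
      with l nl show "s = s'" by (auto simp: doubleton_eq_iff dest: linked_sym)
    qed simp
    ultimately show "?F \<in> rooted_forests G S"
      using HE acyclic_edges_mono[of G H ?F] by (auto simp: forests_def)
  qed
qed

text \<open>The edge \<open>e\<close> leaves the tree of \<open>r\<close>, and its other end lies in
  the tree of some root \<open>t\<close>; adding \<open>e\<close> merges exactly these two
  trees.\<close>

lemma joined_of_rooted: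
  assumes F: "F \<in> rooted_forests G S" and e: "ends G e = {x, y}" "e \<in> edges G"
    and r: "r \<in> S" "linked G F x r" "\<not> linked G F y r" and y: "y \<in> verts G"
  shows "\<exists>t\<in>S - {r}. insert e F \<in> joined_forests G S r t"
proof -
  have FE: "F \<subseteq> edges G" "acyclic_edges G F"
    and cover: "\<And>v. v \<in> verts G \<Longrightarrow> \<exists>s\<in>S. linked G F v s"
    and rel: "\<And>s s'. s \<in> S \<Longrightarrow> s' \<in> S \<Longrightarrow> linked G F s s' \<longleftrightarrow> s = s'"
    using F unfolding forests_def by auto
  from cover[OF y] obtain t where t: "t \<in> S" "linked G F y t" by blast
  have sep: "\<not> linked G F x y"
    using r by (meson linked_sym linked_trans)
  have x_root: "linked G F s x \<longleftrightarrow> s = r" if "s \<in> S" for s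
    using rel[OF that r(1)] r(2) by (meson linked_sym linked_trans)
  have y_root: "linked G F s y \<longleftrightarrow> s = t" if "s \<in> S" for s
    using rel[OF that t(1)] t(2) by (meson linked_sym linked_trans)
  have "linked G (insert e F) s s' \<longleftrightarrow> s = s' \<or> {s, s'} = {r, t}" if "s \<in> S" "s' \<in> S" for s s'
    unfolding linked_insert[OF e(1)] linked_commute[of G F y s'] linked_commute[of G F x s']
    using x_root y_root rel that by (auto simp: doubleton_eq_iff)
  moreover have "\<exists>s\<in>S. linked G (insert e F) v s" if "v \<in> verts G" for v
    using cover[OF that] linked_mono[of G F v _ "insert e F"] by blast
  moreover have "acyclic_edges G (insert e F)"
    using FE(2) e(1) sep by (rule acyclic_edges_insertI)
  ultimately have "insert e F \<in> joined_forests G S r t"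
    using FE(1) e(2) by (auto simp: forests_def)
  then show ?thesis
    using t r(3) by blast
qed

text \<open>If \<open>H\<close> joins \<open>r\<close> to \<open>t\<close>, the removable edges are
  those of the path between them and carry a unit flow. Otherwise no removable edge leaves the tree
  of \<open>r\<close>, and all terms vanish. The right-hand sum has at most one term; this form
  allows summation over \<open>H\<close> and exchange of the sums.\<close>

lemma removal_divergence:
  assumes H: "H \<subseteq> edges G" and r: "r \<in> S"
  shows "(\<Sum>e | e \<in> H \<and> H - {e} \<in> rooted_forests G S. incidence w e *
      (of_bool (linked G (H - {e}) (tail e) r) - of_bool (linked G (H - {e}) (head e) r))) =
    (\<Sum>t | t \<in> S - {r} \<and> H \<in> joined_forests G S r t. of_bool (w = r) - of_bool (w = t))"
    (is "?L = ?R")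
proof (cases "\<exists>t\<in>S - {r}. H \<in> joined_forests G S r t")
  case True
  then obtain t where t: "t \<in> S" "t \<noteq> r" "H \<in> joined_forests G S r t" by blast
  have finite_H: "finite H"
    using H finite_edges finite_subset by blast
  have joined: "acyclic_edges G H" "linked G H r t"
    using t r unfolding forests_def by auto
  have "?L = (\<Sum>e\<in>H. incidence w e *
      (of_bool (linked G (H - {e}) (tail e) r) - of_bool (linked G (H - {e}) (tail e) t)))"
  proof (rule sum.mono_neutral_cong_left)
    fix e assume "e \<in> {e \<in> H. H - {e} \<in> rooted_forests G S}"
    then have nl: "\<not> linked G (H - {e}) r t" and
      split: "linked G (H - {e}) r (tail e) \<and> linked G (H - {e}) (head e) t \<or>
        linked G (H - {e}) r (head e) \<and> linked G (H - {e}) (tail e) t"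
      using rooted_removal_iff[OF t(3) _ r t(1)] t(2) by auto
    \<comment> \<open>The ends of \<open>e\<close> lie on opposite sides, which turns the summand
      into the form used in \<open>path_divergence\<close>.\<close>
    then have "linked G (H - {e}) (head e) r \<longleftrightarrow> linked G (H - {e}) (tail e) t"
      by (meson linked_sym linked_trans)
    then show "incidence w e *
      (of_bool (linked G (H - {e}) (tail e) r) - of_bool (linked G (H - {e}) (head e) r)) =
      incidence w e *
      (of_bool (linked G (H - {e}) (tail e) r) - of_bool (linked G (H - {e}) (tail e) t))"
      by simp
  next
    show "\<forall>e\<in>H - {e \<in> H. H - {e} \<in> rooted_forests G S}. incidence w e *
      (of_bool (linked G (H - {e}) (tail e) r) - of_bool (linked G (H - {e}) (tail e) t)) = 0"
    proof
      fix e assume "e \<in> H - {e \<in> H. H - {e} \<in> rooted_forests G S}"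
      then have "linked G (H - {e}) r t"
        using rooted_removal_iff(1)[OF t(3) _ r t(1)] t(2) by auto
      then have "linked G (H - {e}) (tail e) r \<longleftrightarrow> linked G (H - {e}) (tail e) t"
        by (meson linked_sym linked_trans)
      then show "incidence w e *
        (of_bool (linked G (H - {e}) (tail e) r) - of_bool (linked G (H - {e}) (tail e) t)) = 0"
        by simp
    qed
  qed (use finite_H in auto)
  also have "\<dots> = of_bool (w = r) - of_bool (w = t)"
    by (rule path_divergence[OF H joined])
  also have "\<dots> = ?R"
  proof -
    have "{t' \<in> S - {r}. H \<in> joined_forests G S r t'} = {t}"
      using t joined_forests_unique[OF t(3) _ t(1) _ r t(2)] by blast
    then show ?thesis by simp
  qed
  finally show ?thesis .
next
  case False
  have "?L = 0"
  proof (intro sum.neutral ballI)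
    fix e assume "e \<in> {e \<in> H. H - {e} \<in> rooted_forests G S}"
    then have e: "e \<in> H" "H - {e} \<in> rooted_forests G S" "e \<in> edges G"
      using H by auto
    have H_eq: "insert e (H - {e}) = H" using e(1) by blast
    have "linked G (H - {e}) (tail e) r \<longleftrightarrow> linked G (H - {e}) (head e) r"
    proof (rule ccontr)
      assume "\<not> ?thesis"
      then consider "linked G (H - {e}) (tail e) r" "\<not> linked G (H - {e}) (head e) r"
        | "linked G (H - {e}) (head e) r" "\<not> linked G (H - {e}) (tail e) r" by blast
      then show False
      proof cases
        case 1
        then show False
          using joined_of_rooted[OF e(2) ends_eq[OF e(3)] e(3) r, unfolded H_eq]
            head_in_verts[OF e(3)] False by blast
      next
        case 2
        have "ends G e = {head e, tail e}"
          using ends_eq[OF e(3)] by (simp add: insert_commute)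
        from 2 show False
          using joined_of_rooted[OF e(2) \<open>ends G e = {head e, tail e}\<close> e(3) r, unfolded H_eq]
            tail_in_verts[OF e(3)] False by blast
      qed
    qed
    then show "incidence w e * (of_bool (linked G (H - {e}) (tail e) r) -
        of_bool (linked G (H - {e}) (head e) r)) = 0" by simp
  qed
  with False show ?thesis
    by (metis (no_types, lifting) empty_Collect_eq sum.empty)
qed

text \<open>Net current out of \<open>w\<close> vanishes off the roots: it enters at
  \<open>r\<close> and leaves at each \<open>t\<close> with strength
  \<open>joined_weight S r t\<close>. Pairs \<open>(e, F)\<close> are regrouped by
  \<open>H = insert e F\<close>, and \<open>removal_divergence\<close> evaluates each group.\<close>

lemma kirchhoff:
  assumes S: "finite S" and r: "r \<in> S"
  shows "(\<Sum>e\<in>edges G. incidence w e * current S r e) =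
    (\<Sum>t\<in>S - {r}. joined_weight S r t * (of_bool (w = r) - of_bool (w = t)))"
proof -
  let ?f = "\<lambda>F e. incidence w e * (of_bool (linked G F (tail e) r) - of_bool (linked G F (head e) r))"
  let ?A = "SIGMA e:edges G. {F \<in> rooted_forests G S. \<not> linked G F (tail e) (head e)}"
  let ?B = "SIGMA H:{H. H \<subseteq> edges G \<and> acyclic_edges G H}. {e \<in> H. H - {e} \<in> rooted_forests G S}"
  have finite_H: "finite {H. H \<subseteq> edges G \<and> acyclic_edges G H}"
    using finite_edges by simp
  have "(\<Sum>e\<in>edges G. incidence w e * current S r e) =
    (\<Sum>e\<in>edges G. \<Sum>F | F \<in> rooted_forests G S \<and> \<not> linked G F (tail e) (head e). wt (insert e F) * ?f F e)"
    by (simp add: current_def sum_distrib_left algebra_simps)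
  also have "\<dots> = (\<Sum>(e, F)\<in>?A. wt (insert e F) * ?f F e)"
    using finite_edges finite_forests by (intro sum.Sigma) auto
  also have "\<dots> = (\<Sum>(H, e)\<in>?B. wt H * ?f (H - {e}) e)"
  \<comment> \<open>Adding and removing \<open>e\<close> are inverse: unlinked ends force
    \<open>e\<close> outside \<open>F\<close> and keep the union acyclic, and acyclicity of
    \<open>H\<close> unlinks the ends once \<open>e\<close> is removed.\<close>
  proof (rule sum.reindex_bij_witness[where i = "\<lambda>(H, e). (e, H - {e})" and j = "\<lambda>(e, F). (insert e F, e)"])
    have A: "e \<notin> F" "insert e F - {e} = F" "insert e F \<subseteq> edges G" "acyclic_edges G (insert e F)"
      if "(e, F) \<in> ?A" for e F
    proof -
      have e: "e \<in> edges G" and F: "F \<in> rooted_forests G S" and nl: "\<not> linked G F (tail e) (head e)"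
        using that by auto
      show "e \<notin> F"
        using nl linked_edge[OF _ ends_eq[OF e]] by blast
      then show "insert e F - {e} = F" by blast
      show "insert e F \<subseteq> edges G" "acyclic_edges G (insert e F)"
        using e F acyclic_edges_insertI[OF _ ends_eq[OF e] nl] by (auto simp: forests_def)
    qed
    have B: "insert e (H - {e}) = H" "e \<in> edges G" "\<not> linked G (H - {e}) (tail e) (head e)"
      if "(H, e) \<in> ?B" for e H
    proof -
      have H: "H \<subseteq> edges G" "acyclic_edges G H" "e \<in> H" using that by auto
      then show "insert e (H - {e}) = H" "e \<in> edges G" by auto
      with H(2) show "\<not> linked G (H - {e}) (tail e) (head e)"
        by (intro acyclic_edges_insertD[of G e]) (auto simp: ends_eq)
    qed
    show "(\<lambda>(H, e). (e, H - {e})) ((\<lambda>(e, F). (insert e F, e)) x) = x" if "x \<in> ?A" for x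
      using that A(2) by (cases x) simp
    show "(\<lambda>(e, F). (insert e F, e)) x \<in> ?B" if "x \<in> ?A" for x
      using that A(2-4) by (cases x) simp
    show "(\<lambda>(e, F). (insert e F, e)) ((\<lambda>(H, e). (e, H - {e})) x) = x" if "x \<in> ?B" for x
      using that B(1) by (cases x) simp
    show "(\<lambda>(H, e). (e, H - {e})) x \<in> ?A" if "x \<in> ?B" for x
      using that B(2,3) by (cases x) simp
    show "(case (\<lambda>(e, F). (insert e F, e)) x of (H, e) \<Rightarrow> wt H * ?f (H - {e}) e) =
        (case x of (e, F) \<Rightarrow> wt (insert e F) * ?f F e)" if "x \<in> ?A" for x
      using that A(2) by (cases x) simp
  qed
  also have "\<dots> = (\<Sum>H | H \<subseteq> edges G \<and> acyclic_edges G H.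
      wt H * (\<Sum>e | e \<in> H \<and> H - {e} \<in> rooted_forests G S. ?f (H - {e}) e))"
    using finite_H finite_edges
    by (subst sum.Sigma[symmetric]) (auto simp: sum_distrib_left intro: finite_subset)
  also have "\<dots> = (\<Sum>H | H \<subseteq> edges G \<and> acyclic_edges G H.
      \<Sum>t | t \<in> S - {r} \<and> H \<in> joined_forests G S r t. wt H * (of_bool (w = r) - of_bool (w = t)))"
    by (intro sum.cong refl, subst removal_divergence[OF _ r]) (auto simp: sum_distrib_left)
  also have "\<dots> = (\<Sum>t\<in>S - {r}. \<Sum>H | H \<in> {H. H \<subseteq> edges G \<and> acyclic_edges G H} \<and>
      H \<in> joined_forests G S r t. wt H * (of_bool (w = r) - of_bool (w = t)))"
    using finite_H S by (intro sum.swap_restrict) auto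
  also have "\<dots> = (\<Sum>t\<in>S - {r}. joined_weight S r t * (of_bool (w = r) - of_bool (w = t)))"
    unfolding joined_weight_def sum_distrib_right
    by (intro sum.cong refl) (auto simp: forests_def)
  finally show ?thesis .
qed

section \<open>Green's identity\<close>

lemma sum_incidence:
  assumes "e \<in> edges G"
  shows "(\<Sum>w\<in>verts G. f w * incidence w e) = f (tail e) - f (head e)"
  using finite_verts tail_in_verts[OF assms] head_in_verts[OF assms]
  by (simp add: incidence_def right_diff_distrib sum_subtractf)

text \<open>Summation by parts: the differences of \<open>f\<close> along edges are moved onto the
  divergence of the current, which \<open>kirchhoff\<close> confines to the roots.\<close>

lemma sum_potential_divergence:
  assumes S: "S \<subseteq> verts G" and r: "r \<in> S"
  shows "(\<Sum>t\<in>S - {r}. joined_weight S r t * (f r - f t)) =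
    (\<Sum>e\<in>edges G. (f (tail e) - f (head e)) * current S r e)"
proof -
  have finite_S: "finite S"
    using S finite_verts finite_subset by blast
  have "(\<Sum>e\<in>edges G. (f (tail e) - f (head e)) * current S r e) =
    (\<Sum>e\<in>edges G. \<Sum>w\<in>verts G. f w * incidence w e * current S r e)"
    by (intro sum.cong refl) (simp add: sum_incidence[symmetric] sum_distrib_right)
  also have "\<dots> = (\<Sum>w\<in>verts G. f w * (\<Sum>e\<in>edges G. incidence w e * current S r e))"
    by (subst sum.swap) (simp add: sum_distrib_left mult.assoc)
  also have "\<dots> = (\<Sum>w\<in>verts G. \<Sum>t\<in>S - {r}.
      f w * (joined_weight S r t * (of_bool (w = r) - of_bool (w = t))))"
    by (simp only: kirchhoff[OF finite_S r] sum_distrib_left)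
  also have "\<dots> = (\<Sum>t\<in>S - {r}. \<Sum>w\<in>verts G.
      f w * (joined_weight S r t * (of_bool (w = r) - of_bool (w = t))))"
    by (rule sum.swap)
  also have "\<dots> = (\<Sum>t\<in>S - {r}. joined_weight S r t * (f r - f t))"
  proof (rule sum.cong[OF refl])
    fix t assume "t \<in> S - {r}"
    then have "r \<in> verts G" "t \<in> verts G" using S r by auto
    then have "(\<Sum>w\<in>verts G. f w * (of_bool (w = r) - of_bool (w = t))) = f r - f t"
      using finite_verts by (simp add: right_diff_distrib sum_subtractf)
    then show "(\<Sum>w\<in>verts G. f w * (joined_weight S r t * (of_bool (w = r) - of_bool (w = t)))) =
      joined_weight S r t * (f r - f t)"
      by (simp only: mult.left_commute[of "f _"] sum_distrib_left[symmetric])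
  qed
  finally show ?thesis by simp
qed

text \<open>
  By Ohm's law both sides are the bilinear form \<open>\<Sum>e. a e * current S r e * current S' r' e\<close>.
\<close>

lemma reciprocity:
  assumes "S \<subseteq> verts G" "r \<in> S" "S' \<subseteq> verts G" "r' \<in> S'"
  shows "(\<Sum>t\<in>S - {r}. joined_weight S r t * (potential S' r' r - potential S' r' t)) =
    (\<Sum>t\<in>S' - {r'}. joined_weight S' r' t * (potential S r r' - potential S r t))"
  unfolding sum_potential_divergence[OF assms(1,2)] sum_potential_divergence[OF assms(3,4)]
  by (intro sum.cong refl) (simp add: ohm[symmetric] algebra_simps)

end

section \<open>Spanning forests of a partition\<close>

lemma equiv_connected_rel: "equiv (verts G) (connected_rel G F)"
proof (rule equivI)
  have eq: "(u, w) \<in> connected_rel G F \<longleftrightarrow> u \<in> verts G \<and> w \<in> verts G \<and> linked G F u w" for u w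
    by (simp add: connected_rel_def linked_def)
  show "connected_rel G F \<subseteq> verts G \<times> verts G"
    by (auto simp: eq)
  show "refl_on (verts G) (connected_rel G F)"
    by (auto simp: refl_on_def eq)
  show "sym (connected_rel G F)"
    by (auto simp: sym_def eq intro: linked_sym)
  show "trans (connected_rel G F)"
    by (auto simp: trans_def eq intro: linked_trans)
qed

text \<open>The bijection must send a part to the class of any of its members. Its injectivity says
  that different parts lie in different trees, its surjectivity that every tree meets
  \<open>S\<close>.\<close>

lemma spanning_forests_eq_forests:
  assumes S: "S \<subseteq> verts G" and P: "partition_on S P"
  shows "spanning_forests G P = forests G S (\<lambda>s t. \<exists>p\<in>P. s \<in> p \<and> t \<in> p)"
proof -
  have "(\<exists>T. bij_betw T P (components G F) \<and> (\<forall>p\<in>P. p \<subseteq> T p)) \<longleftrightarrow>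
    (\<forall>v\<in>verts G. \<exists>s\<in>S. linked G F v s) \<and>
    (\<forall>s\<in>S. \<forall>t\<in>S. linked G F s t \<longleftrightarrow> (\<exists>p\<in>P. s \<in> p \<and> t \<in> p))" (is "?L \<longleftrightarrow> ?R") for F
  proof -
    let ?r = "connected_rel G F"
    have equiv: "equiv (verts G) ?r" by (rule equiv_connected_rel)
    have rel: "(u, w) \<in> ?r \<longleftrightarrow> u \<in> verts G \<and> w \<in> verts G \<and> linked G F u w" for u w
      by (simp add: connected_rel_def linked_def)
    have same_part: "(\<exists>p\<in>P. s \<in> p \<and> t \<in> p) \<longleftrightarrow> p = q"
      if "p \<in> P" "q \<in> P" "s \<in> p" "t \<in> q" for s t p q
      using disjointD[OF partition_onD2[OF P]] that by (metis disjoint_iff)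
    have part: "\<exists>p\<in>P. s \<in> p" if "s \<in> S" for s
      using partition_onD1[OF P] that by blast
    have sub: "s \<in> S" "s \<in> verts G" if "p \<in> P" "s \<in> p" for s p
      using partition_onD1[OF P] that S by auto
    have nonempty: "\<exists>s. s \<in> p" if "p \<in> P" for p
      using partition_onD3[OF P] that by (metis equals0I)
    show "?L \<longleftrightarrow> ?R"
    proof
      assume ?L
      then obtain T where T: "bij_betw T P (verts G // ?r)" "\<And>p. p \<in> P \<Longrightarrow> p \<subseteq> T p"
        by (auto simp: components_def)
      have cls: "T p = ?r `` {s}" if "p \<in> P" "s \<in> p" for p s
      proof -
        have "T p \<in> verts G // ?r"
          using T(1) that(1) by (auto simp: bij_betw_def)
        then obtain v where "v \<in> verts G" "T p = ?r `` {v}"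
          by (auto elim: quotientE)
        moreover have "s \<in> T p" using T(2) that by blast
        ultimately show ?thesis
          using equiv_class_eq[OF equiv, of v s] by auto
      qed
      show ?R
      proof (intro conjI ballI)
        fix v assume v: "v \<in> verts G"
        then have "?r `` {v} \<in> T ` P"
          using T(1) by (auto simp: bij_betw_def quotientI)
        then obtain p where p: "p \<in> P" "T p = ?r `` {v}" by auto
        then obtain s where "s \<in> p" using nonempty by blast
        then show "\<exists>s\<in>S. linked G F v s"
          using p T(2) sub rel by fastforce
      next
        fix s t assume st: "s \<in> S" "t \<in> S"
        then obtain p q where pq: "p \<in> P" "s \<in> p" "q \<in> P" "t \<in> q" using part by meson
        have "linked G F s t \<longleftrightarrow> ?r `` {s} = ?r `` {t}"
          using st S eq_equiv_class_iff[OF equiv, of s t] by (auto simp: rel)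
        also have "\<dots> \<longleftrightarrow> p = q"
          using cls pq T(1) by (metis bij_betw_def inj_onD)
        also have "\<dots> \<longleftrightarrow> (\<exists>p\<in>P. s \<in> p \<and> t \<in> p)"
          using same_part pq by metis
        finally show "linked G F s t \<longleftrightarrow> (\<exists>p\<in>P. s \<in> p \<and> t \<in> p)" .
      qed
    next
      assume R: ?R
      \<comment> \<open>The members of a part share one class, so the image of the part is that
        class.\<close>
      let ?T = "\<lambda>p. ?r `` p"
      have cls: "?T p = ?r `` {s}" if "p \<in> P" "s \<in> p" for p s
      proof -
        have "?r `` {t} = ?r `` {s}" if "t \<in> p" for t
          using R \<open>p \<in> P\<close> \<open>s \<in> p\<close> that sub by (intro equiv_class_eq[OF equiv]) (auto simp: rel)
        then show ?thesis using that by blast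
      qed
      have "inj_on ?T P"
      proof (rule inj_onI)
        fix p q assume pq: "p \<in> P" "q \<in> P" "?T p = ?T q"
        obtain s t where st: "s \<in> p" "t \<in> q" using nonempty pq by meson
        then have "?r `` {s} = ?r `` {t}" using cls pq by metis
        then have "linked G F s t"
          using eq_equiv_class_iff[OF equiv, of s t] sub st pq by (auto simp: rel)
        then have "\<exists>p\<in>P. s \<in> p \<and> t \<in> p" using R sub st pq by metis
        then show "p = q" using same_part pq st by metis
      qed
      moreover have "?T ` P = verts G // ?r"
      proof
        show "?T ` P \<subseteq> verts G // ?r"
        proof
          fix c assume "c \<in> ?T ` P"
          then obtain p where p: "p \<in> P" "c = ?T p" by blast
          obtain s where s: "s \<in> p" using nonempty[OF p(1)] by blast
          show "c \<in> verts G // ?r"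
            using cls[OF p(1) s] p(2) sub(2)[OF p(1) s] by (simp add: quotientI)
        qed
        show "verts G // ?r \<subseteq> ?T ` P"
        proof
          fix c assume "c \<in> verts G // ?r"
          then obtain v where v: "v \<in> verts G" "c = ?r `` {v}" by (auto elim: quotientE)
          with R obtain s where s: "s \<in> S" "linked G F v s" by blast
          with part obtain p where p: "p \<in> P" "s \<in> p" by blast
          have "c = ?r `` {s}"
            using v s S by (auto simp: rel intro!: equiv_class_eq[OF equiv])
          with cls[OF p] p(1) show "c \<in> ?T ` P" by (metis imageI)
        qed
      qed
      moreover have "p \<subseteq> ?T p" if "p \<in> P" for p
        using that sub(2)[OF that] by (auto simp: Image_iff rel)
      ultimately show ?L
        unfolding components_def bij_betw_def by (intro exI[of _ ?T] conjI ballI)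
    qed
  qed
  then show ?thesis
    unfolding spanning_forests_def forests_def by (simp only:)
qed

lemma forests_cong:
  "(\<And>s t. s \<in> S \<Longrightarrow> t \<in> S \<Longrightarrow> R s t \<longleftrightarrow> R' s t) \<Longrightarrow> forests G S R = forests G S R'"
  by (simp add: forests_def)

lemma label_partition_same_part:
  assumes "distinct vs" "length cs = length vs" "i < length vs" "j < length vs"
  shows "(\<exists>p\<in>label_partition vs cs. vs ! i \<in> p \<and> vs ! j \<in> p) \<longleftrightarrow> cs ! i = cs ! j"
  using assms by (auto simp: label_partition_def nth_eq_iff_index_eq)

definition covering_forests :: "('v, 'e) multigraph \<Rightarrow> 'v set \<Rightarrow> 'e set set" where
  "covering_forests G S =
     {F. F \<subseteq> edges G \<and> acyclic_edges G F \<and> (\<forall>v\<in>verts G. \<exists>s\<in>S. linked G F v s)}"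

text \<open>Forests for different root sets \<open>S'\<close> become subsets of one family, told
  apart only by how they link the members of \<open>S\<close>.\<close>

lemma forests_subset_eq:
  assumes "S' \<subseteq> S" "S \<subseteq> verts G"
  shows "forests G S' R = {F \<in> covering_forests G S. (\<forall>s\<in>S. \<exists>r\<in>S'. linked G F s r) \<and>
    (\<forall>s\<in>S'. \<forall>t\<in>S'. linked G F s t \<longleftrightarrow> R s t)}"
proof -
  have "(\<forall>v\<in>verts G. \<exists>r\<in>S'. linked G F v r) \<longleftrightarrow>
    (\<forall>v\<in>verts G. \<exists>s\<in>S. linked G F v s) \<and> (\<forall>s\<in>S. \<exists>r\<in>S'. linked G F s r)" for F
    using assms by (meson linked_trans subsetD)
  then show ?thesis
    unfolding forests_def covering_forests_def by simp
qed

section \<open>Four marked vertices\<close>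

locale four_terminals = weighted_multigraph G tail head a
  for G :: "('v, 'e) multigraph" and tail head and a :: "'e \<Rightarrow> 'r::comm_ring_1" +
  fixes v1 v2 v3 v4 :: 'v
  assumes terminals_in_verts: "{v1, v2, v3, v4} \<subseteq> verts G"
    and distinct_terminals: "distinct [v1, v2, v3, v4]"
begin

abbreviation terminals :: "'v set" where
  "terminals \<equiv> {v1, v2, v3, v4}"

text \<open>
  \<open>pattern c1 c2 c3 c4\<close> is the value of \<open>connection\<close> on forests whose trees group the terminals by the
  labels \<open>c1, \<dots>, c4\<close>, so that \<open>W c1 c2 c3 c4\<close> is the paper's \<open>(c1, c2, c3, c4)\<close>.
\<close>

definition connection :: "'e set \<Rightarrow> bool \<times> bool \<times> bool \<times> bool \<times> bool \<times> bool" where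
  "connection F = (linked G F v1 v2, linked G F v1 v3, linked G F v1 v4,
     linked G F v2 v3, linked G F v2 v4, linked G F v3 v4)"

definition connection_weight :: "bool \<times> bool \<times> bool \<times> bool \<times> bool \<times> bool \<Rightarrow> 'r" where
  "connection_weight b = sum wt {F \<in> covering_forests G terminals. connection F = b}"

abbreviation pattern :: "nat \<Rightarrow> nat \<Rightarrow> nat \<Rightarrow> nat \<Rightarrow> bool \<times> bool \<times> bool \<times> bool \<times> bool \<times> bool" where
  "pattern c1 c2 c3 c4 \<equiv> (c1 = c2, c1 = c3, c1 = c4, c2 = c3, c2 = c4, c3 = c4)"

abbreviation W :: "nat \<Rightarrow> nat \<Rightarrow> nat \<Rightarrow> nat \<Rightarrow> 'r" where
  "W c1 c2 c3 c4 \<equiv> connection_weight (pattern c1 c2 c3 c4)"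

lemma finite_covering_forests: "finite (covering_forests G S)"
  by (rule finite_subset[of _ "Pow (edges G)"]) (auto simp: covering_forests_def finite_edges)

lemmas terminals_commute =
  linked_commute[of G _ v2 v1] linked_commute[of G _ v3 v1] linked_commute[of G _ v4 v1]
  linked_commute[of G _ v3 v2] linked_commute[of G _ v4 v2] linked_commute[of G _ v4 v3]

text \<open>Reflexivity and symmetry of \<open>R\<close> reduce the condition on all pairs of
  terminals to the six pairs recorded by \<open>connection\<close>.\<close>

lemma sum_forests:
  assumes "\<And>s. R s s" "\<And>s t. R s t \<longleftrightarrow> R t s"
  shows "sum wt (forests G terminals R) =
    connection_weight (R v1 v2, R v1 v3, R v1 v4, R v2 v3, R v2 v4, R v3 v4)"
  unfolding connection_weight_def
proof (rule arg_cong[of _ _ "sum wt"])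
  have "(\<forall>s\<in>terminals. \<exists>r\<in>terminals. linked G F s r) \<and>
      (\<forall>s\<in>terminals. \<forall>t\<in>terminals. linked G F s t \<longleftrightarrow> R s t) \<longleftrightarrow>
    connection F = (R v1 v2, R v1 v3, R v1 v4, R v2 v3, R v2 v4, R v3 v4)" for F
    by (simp add: connection_def terminals_commute assms(1) assms(2)[of v2 v1] assms(2)[of v3 v1]
        assms(2)[of v4 v1] assms(2)[of v3 v2] assms(2)[of v4 v2] assms(2)[of v4 v3]) blast
  then show "forests G terminals R = {F \<in> covering_forests G terminals. connection F =
      (R v1 v2, R v1 v3, R v1 v4, R v2 v3, R v2 v4, R v3 v4)}"
    unfolding forests_subset_eq[OF subset_refl terminals_in_verts] by simp
qed

lemma potential_eq_covering:
  assumes "S \<subseteq> terminals"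
  shows "potential S r w = sum wt {F \<in> covering_forests G terminals.
    (\<forall>s\<in>terminals. \<exists>q\<in>S. linked G F s q) \<and> (\<forall>s\<in>S. \<forall>t\<in>S. linked G F s t \<longleftrightarrow> s = t) \<and> linked G F w r}"
proof -
  have "potential S r w = (\<Sum>F\<in>rooted_forests G S. if linked G F w r then wt F else 0)"
    by (auto simp: potential_def intro: sum.cong)
  also have "\<dots> = sum wt {F \<in> rooted_forests G S. linked G F w r}"
    using finite_forests by (rule sum.inter_filter[symmetric])
  finally show ?thesis
    unfolding forests_subset_eq[OF assms terminals_in_verts] by (simp only: mem_Collect_eq conj_assoc)
qed

lemma potential_root:
  assumes "r \<in> S" "w \<in> S"
  shows "potential S r w = of_bool (w = r) * sum wt (rooted_forests G S)"
  using assms unfolding potential_def sum_distrib_left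
  by (intro sum.cong refl) (auto simp: forests_def)

text \<open>The fifteen set partitions of four elements.\<close>

definition patterns :: "(bool \<times> bool \<times> bool \<times> bool \<times> bool \<times> bool) set" where
  "patterns =
    {pattern 1 1 1 1, pattern 1 1 1 2, pattern 1 1 2 1, pattern 1 2 1 1, pattern 1 2 2 2,
     pattern 1 1 2 2, pattern 1 2 1 2, pattern 1 2 2 1, pattern 1 1 2 3, pattern 1 2 1 3,
     pattern 1 2 2 3, pattern 1 2 3 1, pattern 1 2 3 2, pattern 1 2 3 3, pattern 1 2 3 4}"

lemma connection_in_patterns: "connection F \<in> patterns"
  by (cases "linked G F v1 v2"; cases "linked G F v1 v3"; cases "linked G F v1 v4";
      cases "linked G F v2 v3"; cases "linked G F v2 v4"; cases "linked G F v3 v4";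
      ((simp add: connection_def patterns_def; fail) | (meson linked_sym linked_trans)))

text \<open>Grouping by \<open>connection\<close> reduces a weighted count to a finite check over
  the fifteen patterns.\<close>

lemma sum_covering_forests:
  assumes "\<And>F. connection F \<in> patterns \<Longrightarrow> X F \<longleftrightarrow> connection F \<in> B"
  shows "sum wt {F \<in> covering_forests G terminals. X F} = sum connection_weight B"
proof -
  let ?A = "{F \<in> covering_forests G terminals. X F}"
  have "sum wt ?A = (\<Sum>b\<in>B. sum wt {F \<in> ?A. connection F = b})"
    using assms connection_in_patterns finite_covering_forests by (intro sum.group[symmetric]) auto
  also have "\<dots> = sum connection_weight B"
    unfolding connection_weight_def using assms connection_in_patterns by (intro sum.cong arg_cong[of _ _ "sum wt"]) auto
  finally show ?thesis .
qed

section \<open>Evaluation of the weights and potentials, and the nine relations\<close>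

lemma joined_weights:
  "joined_weight terminals v1 v2 = W 1 1 2 3"
  "joined_weight terminals v1 v3 = W 1 2 1 3"
  "joined_weight terminals v2 v3 = W 1 2 2 3"
  "joined_weight terminals v1 v4 = W 1 2 3 1"
  "joined_weight terminals v2 v4 = W 1 2 3 2"
  "joined_weight terminals v3 v4 = W 1 2 3 3"
  using distinct_terminals unfolding joined_weight_def
  by (subst sum_forests; auto simp: doubleton_eq_iff)+

lemma joined_weight_commute: "joined_weight S r t = joined_weight S t r"
  by (simp add: joined_weight_def insert_commute)

lemma sum_rooted_forests: "sum wt (rooted_forests G terminals) = W 1 2 3 4"
  using distinct_terminals by (subst sum_forests) auto

text \<open>With only two roots, joining them leaves a single tree, so all three values count the
  spanning trees.\<close>

lemma joined_weight_root_pair: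
  "joined_weight {v2, v1} v2 v1 = W 1 1 1 1"
  "joined_weight {v3, v1} v3 v1 = W 1 1 1 1"
  "joined_weight {v4, v1} v4 v1 = W 1 1 1 1"
proof -
  have *: "joined_weight {k, v1} k v1 = W 1 1 1 1"
    if k: "k \<in> terminals"
      and B: "\<And>F. connection F \<in> patterns \<Longrightarrow>
        (\<forall>s\<in>terminals. linked G F s k \<or> linked G F s v1) \<and> linked G F k v1 \<longleftrightarrow>
        connection F \<in> {pattern 1 1 1 1}" for k
  proof -
    have S: "{k, v1} \<subseteq> terminals" using k by simp
    have "joined_weight {k, v1} k v1 = sum connection_weight {pattern 1 1 1 1}"
      unfolding joined_weight_def forests_subset_eq[OF S terminals_in_verts]
    proof (rule sum_covering_forests)
      fix F assume "connection F \<in> patterns"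
      from B[OF this, symmetric]
      show "(\<forall>s\<in>terminals. \<exists>r\<in>{k, v1}. linked G F s r) \<and>
          (\<forall>s\<in>{k, v1}. \<forall>t\<in>{k, v1}. linked G F s t \<longleftrightarrow> s = t \<or> {s, t} = {k, v1}) \<longleftrightarrow>
        connection F \<in> {pattern 1 1 1 1}"
        using linked_commute[of G F v1 k] by (simp add: insert_commute)
    qed
    then show ?thesis by simp
  qed
  show "joined_weight {v2, v1} v2 v1 = W 1 1 1 1"
    by (rule *, simp, unfold patterns_def, elim insertE emptyE; simp add: connection_def terminals_commute)
  show "joined_weight {v3, v1} v3 v1 = W 1 1 1 1"
    by (rule *, simp, unfold patterns_def, elim insertE emptyE; simp add: connection_def terminals_commute)
  show "joined_weight {v4, v1} v4 v1 = W 1 1 1 1"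
    by (rule *, simp, unfold patterns_def, elim insertE emptyE; simp add: connection_def terminals_commute)
qed

text \<open>Each sum runs over the bipartitions of the terminals that separate \<open>k\<close> from
  \<open>v1\<close> and put \<open>w\<close> with \<open>k\<close>.\<close>

lemma two_tree_potentials:
  "potential {v2, v1} v2 v2 = W 1 2 1 1 + W 1 2 2 2 + W 1 2 1 2 + W 1 2 2 1"
  "potential {v2, v1} v2 v3 = W 1 2 2 2 + W 1 2 2 1"
  "potential {v2, v1} v2 v4 = W 1 2 2 2 + W 1 2 1 2"
  "potential {v3, v1} v3 v2 = W 1 2 2 2 + W 1 2 2 1"
  "potential {v3, v1} v3 v3 = W 1 1 2 1 + W 1 2 2 2 + W 1 1 2 2 + W 1 2 2 1"
  "potential {v3, v1} v3 v4 = W 1 2 2 2 + W 1 1 2 2"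
  "potential {v4, v1} v4 v2 = W 1 2 2 2 + W 1 2 1 2"
  "potential {v4, v1} v4 v3 = W 1 2 2 2 + W 1 1 2 2"
  "potential {v4, v1} v4 v4 = W 1 1 1 2 + W 1 2 2 2 + W 1 1 2 2 + W 1 2 1 2"
proof -
  have *: "potential {k, v1} k w = sum connection_weight B"
    if k: "k \<in> terminals" "k \<noteq> v1"
      and B: "\<And>F. connection F \<in> patterns \<Longrightarrow>
        (\<forall>s\<in>terminals. linked G F s k \<or> linked G F s v1) \<and> \<not> linked G F k v1 \<and> linked G F w k \<longleftrightarrow>
        connection F \<in> B" for k w B
  proof -
    have S: "{k, v1} \<subseteq> terminals" using k by simp
    show ?thesis
      unfolding potential_eq_covering[OF S]
    proof (rule sum_covering_forests)
      fix F assume "connection F \<in> patterns"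
      from B[OF this, symmetric]
      show "(\<forall>s\<in>terminals. \<exists>q\<in>{k, v1}. linked G F s q) \<and>
          (\<forall>s\<in>{k, v1}. \<forall>t\<in>{k, v1}. linked G F s t \<longleftrightarrow> s = t) \<and> linked G F w k \<longleftrightarrow>
        connection F \<in> B"
        using k(2) linked_commute[of G F v1 k] by simp
    qed
  qed
  have neq: "v2 \<noteq> v1" "v3 \<noteq> v1" "v4 \<noteq> v1"
    using distinct_terminals by auto
  show "potential {v2, v1} v2 v2 = W 1 2 1 1 + W 1 2 2 2 + W 1 2 1 2 + W 1 2 2 1"
    by (rule trans[OF *[where B = "{pattern 1 2 1 1, pattern 1 2 2 2, pattern 1 2 1 2, pattern 1 2 2 1}"]], simp, simp add: neq,
        unfold patterns_def, elim insertE emptyE; simp add: neq connection_def terminals_commute)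
  show "potential {v2, v1} v2 v3 = W 1 2 2 2 + W 1 2 2 1"
    by (rule trans[OF *[where B = "{pattern 1 2 2 2, pattern 1 2 2 1}"]], simp, simp add: neq,
        unfold patterns_def, elim insertE emptyE; simp add: neq connection_def terminals_commute)
  show "potential {v2, v1} v2 v4 = W 1 2 2 2 + W 1 2 1 2"
    by (rule trans[OF *[where B = "{pattern 1 2 2 2, pattern 1 2 1 2}"]], simp, simp add: neq,
        unfold patterns_def, elim insertE emptyE; simp add: neq connection_def terminals_commute)
  show "potential {v3, v1} v3 v2 = W 1 2 2 2 + W 1 2 2 1"
    by (rule trans[OF *[where B = "{pattern 1 2 2 2, pattern 1 2 2 1}"]], simp, simp add: neq,
        unfold patterns_def, elim insertE emptyE; simp add: neq connection_def terminals_commute)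
  show "potential {v3, v1} v3 v3 = W 1 1 2 1 + W 1 2 2 2 + W 1 1 2 2 + W 1 2 2 1"
    by (rule trans[OF *[where B = "{pattern 1 1 2 1, pattern 1 2 2 2, pattern 1 1 2 2, pattern 1 2 2 1}"]], simp, simp add: neq,
        unfold patterns_def, elim insertE emptyE; simp add: neq connection_def terminals_commute)
  show "potential {v3, v1} v3 v4 = W 1 2 2 2 + W 1 1 2 2"
    by (rule trans[OF *[where B = "{pattern 1 2 2 2, pattern 1 1 2 2}"]], simp, simp add: neq,
        unfold patterns_def, elim insertE emptyE; simp add: neq connection_def terminals_commute)
  show "potential {v4, v1} v4 v2 = W 1 2 2 2 + W 1 2 1 2"
    by (rule trans[OF *[where B = "{pattern 1 2 2 2, pattern 1 2 1 2}"]], simp, simp add: neq,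
        unfold patterns_def, elim insertE emptyE; simp add: neq connection_def terminals_commute)
  show "potential {v4, v1} v4 v3 = W 1 2 2 2 + W 1 1 2 2"
    by (rule trans[OF *[where B = "{pattern 1 2 2 2, pattern 1 1 2 2}"]], simp, simp add: neq,
        unfold patterns_def, elim insertE emptyE; simp add: neq connection_def terminals_commute)
  show "potential {v4, v1} v4 v4 = W 1 1 1 2 + W 1 2 2 2 + W 1 1 2 2 + W 1 2 1 2"
    by (rule trans[OF *[where B = "{pattern 1 1 1 2, pattern 1 2 2 2, pattern 1 1 2 2, pattern 1 2 1 2}"]], simp, simp add: neq,
        unfold patterns_def, elim insertE emptyE; simp add: neq connection_def terminals_commute)
qed

text \<open>
  Reciprocity between the potentials rooted at all four terminals and those rooted at \<open>{k, v1}\<close>. The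
  first is trivial on terminals, which leaves three-tree forests times two-tree forests.
\<close>

lemma quadratic_relation:
  assumes "i \<in> terminals" "k \<in> terminals" "i \<noteq> v1" "k \<noteq> v1"
  shows "(\<Sum>t\<in>terminals - {i}. joined_weight terminals i t *
      (potential {k, v1} k i - potential {k, v1} k t)) =
    joined_weight {k, v1} k v1 * (of_bool (k = i) * W 1 2 3 4)"
proof -
  have "{k, v1} - {k} = {v1}" using assms(4) by auto
  moreover have "potential terminals i k = of_bool (k = i) * W 1 2 3 4"
    "potential terminals i v1 = 0"
    using assms by (auto simp: potential_root sum_rooted_forests)
  ultimately show ?thesis
    using reciprocity[of terminals i "{k, v1}" k] assms terminals_in_verts by auto
qed

text \<open>These are the cases of \<open>quadratic_relation\<close> with \<open>i\<close> and then
  \<open>k\<close> running through \<open>v2\<close>, \<open>v3\<close>, \<open>v4\<close>.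
  Potentials are left unexpanded; the one at \<open>v1\<close> is zero, so the first term of each
  relation has no difference.\<close>

lemma four_terminal_relations:
  fixes T D A1 A2 A3 A4 A5 A6 B1 B2 B3 B4 B5 B6 B7 :: 'r
  defines "T \<equiv> W 1 1 1 1" and "D \<equiv> W 1 2 3 4"
    and "A1 \<equiv> W 1 1 2 3" and "A2 \<equiv> W 1 2 1 3" and "A3 \<equiv> W 1 2 2 3"
    and "A4 \<equiv> W 1 2 3 1" and "A5 \<equiv> W 1 2 3 2" and "A6 \<equiv> W 1 2 3 3"
    and "B1 \<equiv> W 1 1 1 2" and "B2 \<equiv> W 1 1 2 1" and "B3 \<equiv> W 1 2 1 1"
    and "B4 \<equiv> W 1 2 2 2" and "B5 \<equiv> W 1 1 2 2" and "B6 \<equiv> W 1 2 1 2" and "B7 \<equiv> W 1 2 2 1"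
  shows
    "A1 * (B3 + B4 + B6 + B7) + A3 * ((B3 + B4 + B6 + B7) - (B4 + B7)) + A5 * ((B3 + B4 + B6 + B7) - (B4 + B6)) = T * D"
    "A1 * (B4 + B7) + A3 * ((B4 + B7) - (B2 + B4 + B5 + B7)) + A5 * ((B4 + B7) - (B4 + B5)) = 0"
    "A1 * (B4 + B6) + A3 * ((B4 + B6) - (B4 + B5)) + A5 * ((B4 + B6) - (B1 + B4 + B5 + B6)) = 0"
    "A2 * (B4 + B7) + A3 * ((B4 + B7) - (B3 + B4 + B6 + B7)) + A6 * ((B4 + B7) - (B4 + B6)) = 0"
    "A2 * (B2 + B4 + B5 + B7) + A3 * ((B2 + B4 + B5 + B7) - (B4 + B7)) + A6 * ((B2 + B4 + B5 + B7) - (B4 + B5)) = T * D"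
    "A2 * (B4 + B5) + A3 * ((B4 + B5) - (B4 + B6)) + A6 * ((B4 + B5) - (B1 + B4 + B5 + B6)) = 0"
    "A4 * (B4 + B6) + A5 * ((B4 + B6) - (B3 + B4 + B6 + B7)) + A6 * ((B4 + B6) - (B4 + B7)) = 0"
    "A4 * (B4 + B5) + A5 * ((B4 + B5) - (B4 + B7)) + A6 * ((B4 + B5) - (B2 + B4 + B5 + B7)) = 0"
    "A4 * (B1 + B4 + B5 + B6) + A5 * ((B1 + B4 + B5 + B6) - (B4 + B6)) + A6 * ((B1 + B4 + B5 + B6) - (B4 + B5)) = T * D"
proof -
  have diffs: "terminals - {v2} = {v1, v3, v4}" "terminals - {v3} = {v1, v2, v4}"
    "terminals - {v4} = {v1, v2, v3}"
    using distinct_terminals by auto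
  have grounded: "potential {k, v1} k v1 = 0" if "k \<noteq> v1" for k
    using that by (simp add: potential_root)
  have flipped: "joined_weight terminals v2 v1 = W 1 1 2 3" "joined_weight terminals v3 v1 = W 1 2 1 3"
    "joined_weight terminals v3 v2 = W 1 2 2 3" "joined_weight terminals v4 v1 = W 1 2 3 1"
    "joined_weight terminals v4 v2 = W 1 2 3 2" "joined_weight terminals v4 v3 = W 1 2 3 3"
    by (simp_all only: joined_weights[symmetric] joined_weight_commute[of terminals v2 v1]
        joined_weight_commute[of terminals v3 v1] joined_weight_commute[of terminals v3 v2]
        joined_weight_commute[of terminals v4 v1] joined_weight_commute[of terminals v4 v2]
        joined_weight_commute[of terminals v4 v3])
  have neq: "v1 \<noteq> v2" "v1 \<noteq> v3" "v1 \<noteq> v4" "v2 \<noteq> v3" "v2 \<noteq> v4" "v3 \<noteq> v4"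
    "v2 \<noteq> v1" "v3 \<noteq> v1" "v4 \<noteq> v1" "v3 \<noteq> v2" "v4 \<noteq> v2" "v4 \<noteq> v3"
    using distinct_terminals by auto
  note evaluate = diffs grounded neq joined_weights flipped joined_weight_root_pair two_tree_potentials
  show
    "A1 * (B3 + B4 + B6 + B7) + A3 * ((B3 + B4 + B6 + B7) - (B4 + B7)) + A5 * ((B3 + B4 + B6 + B7) - (B4 + B6)) = T * D"
    "A1 * (B4 + B7) + A3 * ((B4 + B7) - (B2 + B4 + B5 + B7)) + A5 * ((B4 + B7) - (B4 + B5)) = 0"
    "A1 * (B4 + B6) + A3 * ((B4 + B6) - (B4 + B5)) + A5 * ((B4 + B6) - (B1 + B4 + B5 + B6)) = 0"
    "A2 * (B4 + B7) + A3 * ((B4 + B7) - (B3 + B4 + B6 + B7)) + A6 * ((B4 + B7) - (B4 + B6)) = 0"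
    "A2 * (B2 + B4 + B5 + B7) + A3 * ((B2 + B4 + B5 + B7) - (B4 + B7)) + A6 * ((B2 + B4 + B5 + B7) - (B4 + B5)) = T * D"
    "A2 * (B4 + B5) + A3 * ((B4 + B5) - (B4 + B6)) + A6 * ((B4 + B5) - (B1 + B4 + B5 + B6)) = 0"
    "A4 * (B4 + B6) + A5 * ((B4 + B6) - (B3 + B4 + B6 + B7)) + A6 * ((B4 + B6) - (B4 + B7)) = 0"
    "A4 * (B4 + B5) + A5 * ((B4 + B5) - (B4 + B7)) + A6 * ((B4 + B5) - (B2 + B4 + B5 + B7)) = 0"
    "A4 * (B1 + B4 + B5 + B6) + A5 * ((B1 + B4 + B5 + B6) - (B4 + B6)) + A6 * ((B1 + B4 + B5 + B6) - (B4 + B5)) = T * D"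
    unfolding assms
    subgoal using quadratic_relation[of v2 v2] by (simp add: evaluate add.assoc)
    subgoal using quadratic_relation[of v2 v3] by (simp add: evaluate add.assoc)
    subgoal using quadratic_relation[of v2 v4] by (simp add: evaluate add.assoc)
    subgoal using quadratic_relation[of v3 v2] by (simp add: evaluate add.assoc)
    subgoal using quadratic_relation[of v3 v3] by (simp add: evaluate add.assoc)
    subgoal using quadratic_relation[of v3 v4] by (simp add: evaluate add.assoc)
    subgoal using quadratic_relation[of v4 v2] by (simp add: evaluate add.assoc)
    subgoal using quadratic_relation[of v4 v3] by (simp add: evaluate add.assoc)
    subgoal using quadratic_relation[of v4 v4] by (simp add: evaluate add.assoc)
    done
qed

end

section \<open>Linear combination of the relations and the final identity\<close>

lemma relation_combination:
  fixes T D A1 A2 A3 A4 A5 A6 B1 B2 B3 B4 B5 B6 B7 :: "'r::comm_ring_1"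
  assumes
    "A1 * (B3 + B4 + B6 + B7) + A3 * ((B3 + B4 + B6 + B7) - (B4 + B7)) + A5 * ((B3 + B4 + B6 + B7) - (B4 + B6)) = T * D"
    and "A1 * (B4 + B7) + A3 * ((B4 + B7) - (B2 + B4 + B5 + B7)) + A5 * ((B4 + B7) - (B4 + B5)) = 0"
    and "A1 * (B4 + B6) + A3 * ((B4 + B6) - (B4 + B5)) + A5 * ((B4 + B6) - (B1 + B4 + B5 + B6)) = 0"
    and "A2 * (B4 + B7) + A3 * ((B4 + B7) - (B3 + B4 + B6 + B7)) + A6 * ((B4 + B7) - (B4 + B6)) = 0"
    and "A2 * (B2 + B4 + B5 + B7) + A3 * ((B2 + B4 + B5 + B7) - (B4 + B7)) + A6 * ((B2 + B4 + B5 + B7) - (B4 + B5)) = T * D"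
    and "A2 * (B4 + B5) + A3 * ((B4 + B5) - (B4 + B6)) + A6 * ((B4 + B5) - (B1 + B4 + B5 + B6)) = 0"
    and "A4 * (B4 + B6) + A5 * ((B4 + B6) - (B3 + B4 + B6 + B7)) + A6 * ((B4 + B6) - (B4 + B7)) = 0"
    and "A4 * (B4 + B5) + A5 * ((B4 + B5) - (B4 + B7)) + A6 * ((B4 + B5) - (B2 + B4 + B5 + B7)) = 0"
    and "A4 * (B1 + B4 + B5 + B6) + A5 * ((B1 + B4 + B5 + B6) - (B4 + B6)) + A6 * ((B1 + B4 + B5 + B6) - (B4 + B5)) = T * D"
  shows "T * D =
           (1 - x1 - x2) * A4 * B1 + x7 * A2 * B4 + (1 - x3 - x2) * A5 * B1
           + (1 - x1 - x4) * A6 * B1 + x2 * A2 * B2 + (x3 + x2 - x5) * A3 * B2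
           + (1 - x1 - x6) * A6 * B2 + x1 * A1 * B3 + (x1 - x7 + x4) * A3 * B3
           + (x1 - x8 + x6) * A5 * B3 + x5 * A1 * B4 + (x1 - x5 + x4) * A3 * B5
           + (x1 - x5 + x6) * A5 * B5 + x3 * A1 * B6 + (x3 + x2 - x7) * A3 * B6
           + (1 - x1 - x2 + x8 - x6) * A4 * B6 + (x2 + x7 - x4) * A2 * B7
           + (1 - x1 - x7 + x8 - x6) * A6 * B6 + (x1 + x5 - x3) * A1 * B7
           + (1 + x5 - x3 - x2 - x8) * A5 * B7
           + (1 - x1 + x7 - x4 - x8) * A6 * B7
           + x8 * A4 * B4 + x4 * A2 * B5 + x6 * A4 * B5" (is "_ = ?rhs")
proof -
  \<comment> \<open>The relations with \<open>i = k\<close> get coefficients \<open>x1\<close>,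
    \<open>x2\<close> and \<open>1 - x1 - x2\<close>, whose sum 1 yields \<open>T * D\<close> once.
    The six others have right-hand side 0 and free coefficients, giving eight parameters in
    total.\<close>
  have "?rhs = x1 * (A1 * (B3 + B4 + B6 + B7) + A3 * ((B3 + B4 + B6 + B7) - (B4 + B7)) + A5 * ((B3 + B4 + B6 + B7) - (B4 + B6)))
    + (x5 - x3) * (A1 * (B4 + B7) + A3 * ((B4 + B7) - (B2 + B4 + B5 + B7)) + A5 * ((B4 + B7) - (B4 + B5)))
    + (x3 - x1) * (A1 * (B4 + B6) + A3 * ((B4 + B6) - (B4 + B5)) + A5 * ((B4 + B6) - (B1 + B4 + B5 + B6)))
    + (x7 - x4) * (A2 * (B4 + B7) + A3 * ((B4 + B7) - (B3 + B4 + B6 + B7)) + A6 * ((B4 + B7) - (B4 + B6)))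
    + x2 * (A2 * (B2 + B4 + B5 + B7) + A3 * ((B2 + B4 + B5 + B7) - (B4 + B7)) + A6 * ((B2 + B4 + B5 + B7) - (B4 + B5)))
    + (x4 - x2) * (A2 * (B4 + B5) + A3 * ((B4 + B5) - (B4 + B6)) + A6 * ((B4 + B5) - (B1 + B4 + B5 + B6)))
    + (x8 - x6) * (A4 * (B4 + B6) + A5 * ((B4 + B6) - (B3 + B4 + B6 + B7)) + A6 * ((B4 + B6) - (B4 + B7)))
    + (x1 + x2 + x6 - 1) * (A4 * (B4 + B5) + A5 * ((B4 + B5) - (B4 + B7)) + A6 * ((B4 + B5) - (B2 + B4 + B5 + B7)))
    + (1 - x1 - x2) * (A4 * (B1 + B4 + B5 + B6) + A5 * ((B1 + B4 + B5 + B6) - (B4 + B6)) + A6 * ((B1 + B4 + B5 + B6) - (B4 + B5)))"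
    by (simp add: algebra_simps)
  also have "\<dots> = x1 * (T * D) + x2 * (T * D) + (1 - x1 - x2) * (T * D)"
    unfolding assms by simp
  also have "\<dots> = T * D"
    by (simp add: algebra_simps)
  finally show ?thesis by simp
qed

theorem theorem7:
  fixes G :: "('v, 'e) multigraph"
    and v1 v2 v3 v4 :: 'v
    and x1 x2 x3 x4 x5 x6 x7 x8 :: "('e, 'a::comm_ring_1) edge_poly"
  assumes "finite_multigraph G"
    and "{v1, v2, v3, v4} \<subseteq> verts G"
    and "distinct [v1, v2, v3, v4]"
  shows
    "let S = marked_forest_poly G [v1, v2, v3, v4];
       A1 = S [1, 1, 2, 3];
       A2 = S [1, 2, 1, 3];
       A3 = S [1, 2, 2, 3];
       A4 = S [1, 2, 3, 1];
       A5 = S [1, 2, 3, 2];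
       A6 = S [1, 2, 3, 3];
       B1 = S [1, 1, 1, 2];
       B2 = S [1, 1, 2, 1];
       B3 = S [1, 2, 1, 1];
       B4 = S [1, 2, 2, 2];
       B5 = S [1, 1, 2, 2];
       B6 = S [1, 2, 1, 2];
       B7 = S [1, 2, 2, 1]
     in S [1, 1, 1, 1] * S [1, 2, 3, 4] =
           (1 - x1 - x2) * A4 * B1 + x7 * A2 * B4 + (1 - x3 - x2) * A5 * B1
           + (1 - x1 - x4) * A6 * B1 + x2 * A2 * B2 + (x3 + x2 - x5) * A3 * B2
           + (1 - x1 - x6) * A6 * B2 + x1 * A1 * B3 + (x1 - x7 + x4) * A3 * B3
           + (x1 - x8 + x6) * A5 * B3 + x5 * A1 * B4 + (x1 - x5 + x4) * A3 * B5
           + (x1 - x5 + x6) * A5 * B5 + x3 * A1 * B6 + (x3 + x2 - x7) * A3 * B6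
           + (1 - x1 - x2 + x8 - x6) * A4 * B6 + (x2 + x7 - x4) * A2 * B7
           + (1 - x1 - x7 + x8 - x6) * A6 * B6 + (x1 + x5 - x3) * A1 * B7
           + (1 + x5 - x3 - x2 - x8) * A5 * B7
           + (1 - x1 + x7 - x4 - x8) * A6 * B7
           + x8 * A4 * B4 + x4 * A2 * B5 + x6 * A4 * B5"
proof -
  obtain tail head where ends: "\<And>e. e \<in> edges G \<Longrightarrow>
      tail e \<in> verts G \<and> head e \<in> verts G \<and> ends G e = {tail e, head e}"
    using assms(1) unfolding finite_multigraph_def by metis
  interpret four_terminals G tail head "edge_var :: 'e \<Rightarrow> ('e, 'a) edge_poly" v1 v2 v3 v4
    using assms ends by unfold_locales (auto simp: finite_multigraph_def)
  have poly_eq: "marked_forest_poly G [v1, v2, v3, v4] [c1, c2, c3, c4] = W c1 c2 c3 c4" for c1 c2 c3 c4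
  proof -
    let ?vs = "[v1, v2, v3, v4]" and ?cs = "[c1, c2, c3, c4]"
    let ?R = "\<lambda>s t. \<exists>p\<in>label_partition ?vs ?cs. s \<in> p \<and> t \<in> p"
    have part: "partition_on terminals (label_partition ?vs ?cs)"
      using partition_on_label_partition[OF assms(3), of ?cs] by simp
    have R: "?R (?vs ! i) (?vs ! j) \<longleftrightarrow> ?cs ! i = ?cs ! j" if "i < 4" "j < 4" for i j
      using label_partition_same_part[OF assms(3), of ?cs i j] that by simp
    have R_sym: "?R s t \<longleftrightarrow> ?R t s" for s t by blast
    have "marked_forest_poly G ?vs ?cs = sum wt (forests G terminals ?R)"
      unfolding marked_forest_poly_def forest_poly_def
        spanning_forests_eq_forests[OF terminals_in_verts part] wt_def ..
    \<comment> \<open>\<open>sum_forests\<close> asks for reflexivity at every vertex, but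
      \<open>?R\<close> is reflexive only on the terminals. Adding equality changes nothing
      there.\<close>
    also have "forests G terminals ?R = forests G terminals (\<lambda>s t. s = t \<or> ?R s t)"
      using partition_onD1[OF part] by (intro forests_cong) blast
    also have "sum wt \<dots> = W c1 c2 c3 c4"
      using assms(3) R[of 0 1] R[of 0 2] R[of 0 3] R[of 1 2] R[of 1 3] R[of 2 3]
      by (subst sum_forests) (simp_all add: R_sym eq_commute)
    finally show ?thesis .
  qed
  show ?thesis
    unfolding Let_def poly_eq by (rule relation_combination[OF four_terminal_relations])
qed

end
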